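(* Let $\mathbf{A}\cdot\mathbf{x}=\mathbf{y}$ be a right system of linear equations with coefficient matrix $\mathbf{A}\in\mathrm{M}(n,\mathbf{H})$, column of constants $\mathbf{y}=(y_1,\ldots,y_n)^T\in\mathbf{H}^{n\times 1}$ and column of unknowns $\mathbf{x}=(x_1,\ldots,x_n)^T$. If $\mathbf{A}$ is Hermitian and $\det\mathbf{A}\neq 0$, then the solution of the system is given componentwise by $$x_j=\frac{\mathrm{cdet}_j\,\mathbf{A}_{.j}(\mathbf{y})}{\det\mathbf{A}},\qquad j=1,\ldots,n.$$
   Context: $\mathbf{H}$ denotes the coquaternions (split quaternions): the associative real algebra with basis $1,i,j,k$ and $i^2=-1$, $j^2=k^2=1$, $ij=-ji=k$, $jk=-kj=-i$, $ik=-ki=-j$. The conjugate of $q=q_0+q_1i+q_2j+q_3k$ is $\overline{q}=q_0-q_1i-q_2j-q_3k$. $\mathrm{M}(n,\mathbf{H})$ is the ring of $n\times n$ matrices over $\mathbf{H}$. $\mathbf{A}^*=(\overline{a_{ji}})$ is the conjugate transpose of $\mathbf{A}=(a_{ij})$, and $\mathbf{A}$ is Hermitian if $\mathbf{A}^*=\mathbf{A}$. Row and column determinants. For a cycle $\gamma$ (possibly a fixed point) of a permutation and an element $s$ of $\gamma$, put $a_\gamma^{(s)}=a_{s\,\gamma(s)}\,a_{\gamma(s)\,\gamma^2(s)}\cdots a_{\gamma^{-1}(s)\,s}$ (equal to $a_{ss}$ for a fixed point). Given an index $i$, write $\sigma\in S_n$ as a product of its $r$ disjoint cycles (fixed points included)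 $\gamma_1,\dots,\gamma_r$, where $\gamma_1$ contains $i$ and the minimal elements $m_t$ of $\gamma_t$ satisfy $m_2<m_3<\dots<m_r$. Then $\mathrm{rdet}_i\,\mathbf{A}=\sum_{\sigma\in S_n}(-1)^{n-r}a_{\gamma_1}^{(i)}a_{\gamma_2}^{(m_2)}\cdots a_{\gamma_r}^{(m_r)}$ and $\mathrm{cdet}_i\,\mathbf{A}=\sum_{\sigma\in S_n}(-1)^{n-r}a_{\gamma_r}^{(m_r)}\cdots a_{\gamma_2}^{(m_2)}a_{\gamma_1}^{(i)}$ (factors multiplied in the order written). For Hermitian $\mathbf{A}$ it is known that all $\mathrm{rdet}_i\,\mathbf{A}$ and $\mathrm{cdet}_i\,\mathbf{A}$ coincide and are real; the common value is denoted $\det\mathbf{A}$. $\mathbf{A}_{.j}(\mathbf{y})$ is the matrix obtained from $\mathbf{A}$ by replacing its $j$-th column with $\mathbf{y}$. *)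

theory Defs
  imports "HOL-Analysis.Analysis" "HOL-Combinatorics.Cycles"
begin

section \<open>Coquaternions\<close>

text \<open>\<open>Coquat a b c d\<close> is \<open>a + b i + c j + d k\<close>.\<close>

codatatype coquat = Coquat (Cq0: real) (Cq1: real) (Cq2: real) (Cq3: real)

lemma coquat_eq_iff:
  "p = q \<longleftrightarrow> Cq0 p = Cq0 q \<and> Cq1 p = Cq1 q \<and> Cq2 p = Cq2 q \<and> Cq3 p = Cq3 q"
  by (auto intro: coquat.expand)

instantiation coquat :: ab_group_add
begin

primcorec zero_coquat where
  "Cq0 0 = 0" | "Cq1 0 = 0" | "Cq2 0 = 0" | "Cq3 0 = 0"

primcorec plus_coquat where
  "Cq0 (p + q) = Cq0 p + Cq0 q"
| "Cq1 (p + q) = Cq1 p + Cq1 q"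
| "Cq2 (p + q) = Cq2 p + Cq2 q"
| "Cq3 (p + q) = Cq3 p + Cq3 q"

primcorec uminus_coquat where
  "Cq0 (- p) = - Cq0 p"
| "Cq1 (- p) = - Cq1 p"
| "Cq2 (- p) = - Cq2 p"
| "Cq3 (- p) = - Cq3 p"

primcorec minus_coquat where
  "Cq0 (p - q) = Cq0 p - Cq0 q"
| "Cq1 (p - q) = Cq1 p - Cq1 q"
| "Cq2 (p - q) = Cq2 p - Cq2 q"
| "Cq3 (p - q) = Cq3 p - Cq3 q"

instance
  by standard (simp_all add: coquat_eq_iff)

end

instantiation coquat :: ring_1
begin

primcorec one_coquat where
  "Cq0 1 = 1" | "Cq1 1 = 0" | "Cq2 1 = 0" | "Cq3 1 = 0"

primcorec times_coquat where
  "Cq0 (p * q) = Cq0 p * Cq0 q - Cq1 p * Cq1 q + Cq2 p * Cq2 q + Cq3 p * Cq3 q"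
| "Cq1 (p * q) = Cq0 p * Cq1 q + Cq1 p * Cq0 q - Cq2 p * Cq3 q + Cq3 p * Cq2 q"
| "Cq2 (p * q) = Cq0 p * Cq2 q - Cq1 p * Cq3 q + Cq2 p * Cq0 q + Cq3 p * Cq1 q"
| "Cq3 (p * q) = Cq0 p * Cq3 q + Cq1 p * Cq2 q - Cq2 p * Cq1 q + Cq3 p * Cq0 q"

instance
  by standard (simp_all add: coquat_eq_iff algebra_simps)

end

instantiation coquat :: real_algebra_1
begin

primcorec scaleR_coquat where
  "Cq0 (r *\<^sub>R q) = r * Cq0 q"
| "Cq1 (r *\<^sub>R q) = r * Cq1 q"
| "Cq2 (r *\<^sub>R q) = r * Cq2 q"
| "Cq3 (r *\<^sub>R q) = r * Cq3 q"

instance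
  by standard (simp_all add: coquat_eq_iff algebra_simps)

end

lemma coquat_mult_table:
  defines "i \<equiv> Coquat 0 1 0 0" and "j \<equiv> Coquat 0 0 1 0" and "k \<equiv> Coquat 0 0 0 1"
  shows "i * i = - 1" "j * j = 1" "k * k = 1"
    "i * j = k" "j * i = - k" "j * k = - i" "k * j = i" "i * k = - j" "k * i = j"
  unfolding i_def j_def k_def by (simp_all add: coquat_eq_iff)

lemma Coquat_eq_basis:
  "Coquat a b c d =
    of_real a + b *\<^sub>R Coquat 0 1 0 0 + c *\<^sub>R Coquat 0 0 1 0 + d *\<^sub>R Coquat 0 0 0 1"
  by (simp add: coquat_eq_iff of_real_def)

primcorec cq_cnj :: "coquat \<Rightarrow> coquat" where
  "Cq0 (cq_cnj q) = Cq0 q"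
| "Cq1 (cq_cnj q) = - Cq1 q"
| "Cq2 (cq_cnj q) = - Cq2 q"
| "Cq3 (cq_cnj q) = - Cq3 q"


section \<open>Hermitian matrices\<close>

definition conj_transpose :: "coquat^'n^'m \<Rightarrow> coquat^'m^'n" where
  "conj_transpose A = (\<chi> i j. cq_cnj (A $ j $ i))"

definition hermitian :: "coquat^'n^'n \<Rightarrow> bool" where
  "hermitian A \<longleftrightarrow> conj_transpose A = A"

definition replace_col :: "'a^'n^'m \<Rightarrow> 'n \<Rightarrow> 'a^'m \<Rightarrow> 'a^'n^'m" where
  "replace_col A j y = (\<chi> i l. if l = j then y $ i else A $ i $ l)"


section \<open>Row and column determinants\<close>

text \<open>
  The index set \<open>{1,\<dots>,n}\<close> is rendered by a finite linearly ordered type; the order is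
  needed to speak of minimal elements of cycles.  The library list \<open>support \<sigma> s\<close> is
  \<open>[s, \<sigma> s, \<sigma>\<^sup>2 s, \<dots>, \<sigma>\<^sup>-\<^sup>1 s]\<close>, the cycle of \<open>\<sigma>\<close> through \<open>s\<close> (it is \<open>[s]\<close> for a fixed point).
\<close>

definition cycle_sets :: "('n \<Rightarrow> 'n) \<Rightarrow> 'n set set" where
  "cycle_sets \<sigma> = range (\<lambda>s. set (support \<sigma> s))"

definition cycle_prod :: "coquat^'n^'n \<Rightarrow> ('n \<Rightarrow> 'n) \<Rightarrow> 'n \<Rightarrow> coquat" where
  "cycle_prod A \<sigma> s = prod_list (map (\<lambda>t. A $ t $ \<sigma> t) (support \<sigma> s))"

text \<open>The list \<open>[i, m\<^sub>2, \<dots>, m\<^sub>r]\<close> of starting points of the cycles, with \<open>m\<^sub>2 < \<dots> < m\<^sub>r\<close>.\<close>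

definition cycle_starts :: "'n::{finite,linorder} \<Rightarrow> ('n \<Rightarrow> 'n) \<Rightarrow> 'n list" where
  "cycle_starts i \<sigma> = i # sorted_list_of_set (Min ` {C \<in> cycle_sets \<sigma>. i \<notin> C})"

definition rdet :: "'n::{finite,linorder} \<Rightarrow> coquat^'n::{finite,linorder}^'n::{finite,linorder} \<Rightarrow> coquat" where
  "rdet i A = (\<Sum>\<sigma> | \<sigma> permutes UNIV.
     (- 1) ^ (CARD('n) - card (cycle_sets \<sigma>)) *
     prod_list (map (cycle_prod A \<sigma>) (cycle_starts i \<sigma>)))"

definition cdet :: "'n::{finite,linorder} \<Rightarrow> coquat^'n::{finite,linorder}^'n::{finite,linorder} \<Rightarrow> coquat" where
  "cdet i A = (\<Sum>\<sigma> | \<sigma> permutes UNIV.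
     (- 1) ^ (CARD('n) - card (cycle_sets \<sigma>)) *
     prod_list (map (cycle_prod A \<sigma>) (rev (cycle_starts i \<sigma>))))"

text \<open>
  The common real value of all row and column determinants; it exists (and is unique)
  for Hermitian matrices, and \<open>hdet\<close> is meaningful only for these.
\<close>

definition hdet :: "coquat^'n::{finite,linorder}^'n::{finite,linorder} \<Rightarrow> real" where
  "hdet A = (THE d. \<forall>i. rdet i A = of_real d \<and> cdet i A = of_real d)"

end

theory Submission
  imports Defs
begin

text \<open>
  For Hermitian \<open>A\<close>, reversing one cycle of a permutation conjugates the corresponding cycle
  product and changes nothing else.  Averaging over such reversals replaces cycle products by
  their real parts, and real parts of cycle products depend neither on the starting point of the
  cycle nor on the order of the factors.  Hence all row and column determinants of \<open>A\<close> equal the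
  real number \<open>\<Sum>\<sigma>. \<plusminus> \<Prod>C. Re a\<^sub>C\<close>, the product ranging over the cycles \<open>C\<close> of \<open>\<sigma>\<close>.

  If column \<open>j\<close> of \<open>A\<close> is overwritten by column \<open>k \<noteq> j\<close>, composing with the transposition
  \<open>(j k)\<close> matches the permutations with \<open>j\<close> and \<open>k\<close> in one cycle to those with \<open>j\<close> and \<open>k\<close> in
  different cycles.  After averaging over the orientation of the cycle through \<open>k\<close>, matched terms
  cancel, so this column determinant vanishes.

  As \<open>y \<mapsto> cdet\<^sub>j A\<^sub>.\<^sub>j(y)\<close> is right linear, this yields a left inverse \<open>L\<close> of \<open>A\<close>.  Its conjugate
  transpose is a right inverse, hence equals \<open>L\<close>.
\<close>

section \<open>Cycles of a permutation as lists\<close>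

text \<open>Cyclic succession is encoded as a single list equation, so that rotating, reversing,
  cutting and joining cycles become list calculations.\<close>

definition cycle_list :: "('a \<Rightarrow> 'a) \<Rightarrow> 'a list \<Rightarrow> bool" where
  "cycle_list f xs \<longleftrightarrow> xs \<noteq> [] \<and> distinct xs \<and> map f xs = rotate1 xs"

text \<open>A constant for the abbreviation \<open>support\<close>, which the simplifier would otherwise take apart.\<close>

definition cycle_from :: "('a \<Rightarrow> 'a) \<Rightarrow> 'a \<Rightarrow> 'a list" where
  "cycle_from f s = support f s"

lemma rotate1_image_nth:
  assumes "map f xs = rotate1 xs" and "i < length xs"
  shows "f (xs ! i) = xs ! (Suc i mod length xs)"
  using assms by (metis nth_map nth_rotate1)

text \<open>Iterating \<open>f\<close> from the head walks around the list, and distinctness forces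
  the first return after \<open>length xs\<close> steps. Cycles of altered permutations are computed
  below by exhibiting a \<open>cycle_list\<close> with the right head.\<close>

lemma cycle_from_eq:
  assumes "cycle_list f xs"
  shows "cycle_from f (hd xs) = xs"
proof -
  let ?n = "length xs"
  have n: "0 < ?n" and d: "distinct xs" and m: "map f xs = rotate1 xs"
    using assms by (auto simp: cycle_list_def)
  have pow: "(f ^^ i) (hd xs) = xs ! (i mod ?n)" for i
  proof (induction i)
    case 0
    then show ?case using n by (simp add: hd_conv_nth)
  next
    case (Suc i)
    then show ?case using rotate1_image_nth[OF m, of "i mod ?n"] n by (simp add: mod_Suc_eq)
  qed
  have "least_power f (hd xs) = ?n"
    unfolding least_power_def
  proof (rule Least_equality)
    show "(f ^^ ?n) (hd xs) = hd xs \<and> 0 < ?n"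
      using n pow[of ?n] by (simp add: hd_conv_nth)
  next
    fix k assume k: "(f ^^ k) (hd xs) = hd xs \<and> 0 < k"
    then have "xs ! (k mod ?n) = xs ! 0"
      using n pow[of k] by (simp add: hd_conv_nth)
    then have "k mod ?n = 0"
      using d n nth_eq_iff_index_eq[OF d, of "k mod ?n" 0] by simp
    then show "?n \<le> k"
      using k by (meson dvd_imp_le mod_eq_0_iff_dvd)
  qed
  then show ?thesis
    unfolding cycle_from_def
    by (intro nth_equalityI) (simp_all add: pow)
qed

context
  fixes \<sigma> :: "'n::finite \<Rightarrow> 'n"
  assumes perm: "\<sigma> permutes UNIV"
begin

lemma permutation_of_permutes: "permutation \<sigma>"
  using perm by (auto simp: permutation_permutes intro!: exI[of _ UNIV])

lemma cycle_from_props: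
  "cycle_list \<sigma> (cycle_from \<sigma> s)" "hd (cycle_from \<sigma> s) = s"
proof -
  let ?n = "least_power \<sigma> s"
  have n: "0 < ?n" and e: "(\<sigma> ^^ ?n) s = s"
    using least_power_of_permutation[OF permutation_of_permutes] by auto
  have ne: "cycle_from \<sigma> s \<noteq> []" using n by (simp add: cycle_from_def)
  have "map \<sigma> (cycle_from \<sigma> s) = rotate1 (cycle_from \<sigma> s)"
  proof (rule nth_equalityI)
    fix i assume "i < length (map \<sigma> (cycle_from \<sigma> s))"
    then have i: "i < ?n" by (simp add: cycle_from_def)
    show "map \<sigma> (cycle_from \<sigma> s) ! i = rotate1 (cycle_from \<sigma> s) ! i"
    proof (cases "Suc i = ?n")
      case True
      with e have "\<sigma> ((\<sigma> ^^ i) s) = s" by (metis funpow.simps(2) o_apply)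
      with i True show ?thesis by (simp add: cycle_from_def nth_rotate1)
    next
      case False
      with i show ?thesis by (simp add: cycle_from_def nth_rotate1)
    qed
  qed simp
  then show "cycle_list \<sigma> (cycle_from \<sigma> s)"
    using ne cycle_of_permutation[OF permutation_of_permutes, of s, folded cycle_from_def]
    by (simp add: cycle_list_def)
  show "hd (cycle_from \<sigma> s) = s"
    using n by (simp add: cycle_from_def hd_map)
qed

end

lemma cycle_from_self:
  fixes \<sigma> :: "'n::finite \<Rightarrow> 'n"
  assumes "\<sigma> permutes UNIV"
  shows "s \<in> set (cycle_from \<sigma> s)"
  using cycle_from_props[OF assms, of s] by (metis cycle_list_def list.set_sel(1))

lemma cycle_from_Cons:
  fixes \<sigma> :: "'n::finite \<Rightarrow> 'n"
  assumes "\<sigma> permutes UNIV"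
  obtains l where "cycle_from \<sigma> s = s # l"
  using cycle_from_props[OF assms, of s] by (metis cycle_list_def list.collapse)

lemma cycle_list_rotate1: "cycle_list f xs \<Longrightarrow> cycle_list f (rotate1 xs)"
  by (auto simp: cycle_list_def rotate1_map[symmetric])

lemma cycle_list_rotate: "cycle_list f xs \<Longrightarrow> cycle_list f (rotate n xs)"
  by (induction n) (auto intro: cycle_list_rotate1)

lemma cycle_from_rotate:
  assumes "cycle_list f xs" and "t \<in> set xs"
  obtains n where "cycle_from f t = rotate n xs"
proof -
  obtain us vs where xs: "xs = us @ t # vs" using assms(2) by (meson split_list)
  then have r: "rotate (length us) xs = t # vs @ us" by (simp add: rotate_append)
  have "cycle_from f (hd (rotate (length us) xs)) = rotate (length us) xs"
    using cycle_from_eq[OF cycle_list_rotate[OF assms(1)]] .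
  then show thesis using r that by (metis list.sel(1))
qed

lemma set_cycle_from_eq:
  assumes "cycle_list f xs" and "t \<in> set xs"
  shows "set (cycle_from f t) = set xs"
proof -
  obtain n where "cycle_from f t = rotate n xs" by (rule cycle_from_rotate[OF assms])
  then show ?thesis by simp
qed

lemma cycle_sets_eq:
  fixes \<sigma> :: "'n::finite \<Rightarrow> 'n"
  assumes "\<sigma> permutes UNIV"
  shows "cycle_sets \<sigma> = {set xs | xs. cycle_list \<sigma> xs}"
proof -
  have "cycle_sets \<sigma> = range (\<lambda>s. set (cycle_from \<sigma> s))"
    by (simp only: cycle_sets_def cycle_from_def)
  also have "\<dots> = {set xs | xs. cycle_list \<sigma> xs}"
  proof (intro equalityI subsetI)
    fix C assume "C \<in> {set xs | xs. cycle_list \<sigma> xs}"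
    then obtain xs where "C = set xs" "cycle_list \<sigma> xs" by auto
    then have "C = set (cycle_from \<sigma> (hd xs))" by (simp add: cycle_from_eq)
    then show "C \<in> range (\<lambda>s. set (cycle_from \<sigma> s))" by simp
  next
    fix C assume "C \<in> range (\<lambda>s. set (cycle_from \<sigma> s))"
    then obtain s where "C = set (cycle_from \<sigma> s)" by auto
    then show "C \<in> {set xs | xs. cycle_list \<sigma> xs}"
      using cycle_from_props(1)[OF assms] by auto
  qed
  finally show ?thesis .
qed

lemma cycle_sets_eq_set_cycle_from:
  fixes \<sigma> :: "'n::finite \<Rightarrow> 'n"
  assumes "\<sigma> permutes UNIV" and "C \<in> cycle_sets \<sigma>" and "t \<in> C"
  shows "C = set (cycle_from \<sigma> t)"
proof -
  obtain xs where "C = set xs" "cycle_list \<sigma> xs"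
    using assms(2) by (auto simp: cycle_sets_eq[OF assms(1)])
  then show ?thesis using set_cycle_from_eq[of \<sigma> xs t] assms(3) by simp
qed

lemma set_cycle_from_in_cycle_sets:
  "set (cycle_from \<sigma> t) \<in> cycle_sets \<sigma>"
  unfolding cycle_sets_def cycle_from_def by (rule rangeI)

lemma cycle_sets_nonempty:
  fixes \<sigma> :: "'n::finite \<Rightarrow> 'n"
  shows "\<sigma> permutes UNIV \<Longrightarrow> C \<in> cycle_sets \<sigma> \<Longrightarrow> C \<noteq> {}"
  by (auto simp: cycle_sets_eq cycle_list_def)

lemma cycle_sets_insert:
  fixes \<sigma> :: "'n::finite \<Rightarrow> 'n"
  assumes "\<sigma> permutes UNIV"
  shows "cycle_sets \<sigma> = insert (set (cycle_from \<sigma> j)) {C \<in> cycle_sets \<sigma>. j \<notin> C}"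
proof (intro equalityI subsetI)
  fix C assume "C \<in> cycle_sets \<sigma>"
  then show "C \<in> insert (set (cycle_from \<sigma> j)) {C \<in> cycle_sets \<sigma>. j \<notin> C}"
    using cycle_sets_eq_set_cycle_from[OF assms, of C j] by auto
qed (auto simp: set_cycle_from_in_cycle_sets)

text \<open>Ensures that the truncated subtraction in the sign exponent is a true one when cycles
  are counted in \<open>cycle_sign_merge\<close>.\<close>

lemma card_cycle_sets_le:
  fixes \<sigma> :: "'n::finite \<Rightarrow> 'n"
  shows "card (cycle_sets \<sigma>) \<le> CARD('n)"
  unfolding cycle_sets_def by (rule card_image_le) simp

text \<open>The inverse runs through the same cycle backwards; as the start \<open>a\<close> stays
  in front, only the tail is reversed.\<close>

lemma cycle_list_inv:
  fixes \<sigma> :: "'n::finite \<Rightarrow> 'n"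
  assumes "\<sigma> permutes UNIV" and "cycle_list \<sigma> (a # l)"
  shows "cycle_list (inv \<sigma>) (a # rev l)"
proof -
  have "map (inv \<sigma>) (map \<sigma> (a # l)) = a # l"
    using permutes_inverses(2)[OF assms(1)] by (simp add: map_idI)
  moreover have "map \<sigma> (a # l) = l @ [a]"
    using assms(2) by (simp add: cycle_list_def)
  ultimately have "map (inv \<sigma>) (l @ [a]) = a # l" by metis
  then have "rev (map (inv \<sigma>) (l @ [a])) = rev (a # l)" by simp
  then show ?thesis using assms(2) by (simp add: cycle_list_def rev_map)
qed

lemma cycle_list_cong:
  assumes "cycle_list f xs" and "\<And>x. x \<in> set xs \<Longrightarrow> f x = g x"
  shows "cycle_list g xs"
  using assms by (metis cycle_list_def map_eq_conv)

lemma cycle_list_closed: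
  assumes "cycle_list f xs" and "x \<in> set xs"
  shows "f x \<in> set xs"
  using assms by (metis cycle_list_def image_eqI set_map set_rotate1)

text \<open>Under \<open>f\<close> the last entry of the first cycle returns to \<open>j\<close> and
  that of the second to \<open>k\<close>; the transposition exchanges these two targets, which links
  the cycles.\<close>

lemma cycle_list_merge:
  assumes "cycle_list f (j # p)" "cycle_list f (k # q)" "set (j # p) \<inter> set (k # q) = {}"
  shows "cycle_list (Transposition.transpose j k \<circ> f) (j # p @ k # q)"
proof -
  have "map (Transposition.transpose j k) p = p" "map (Transposition.transpose j k) q = q"
    using assms by (auto simp: cycle_list_def Transposition.transpose_def intro!: map_idI)
  moreover have "map f (j # p @ k # q) = p @ [j] @ q @ [k]"
    using assms(1,2) by (simp add: cycle_list_def)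
  ultimately have "map (Transposition.transpose j k) (map f (j # p @ k # q)) = p @ k # q @ [j]"
    by (simp only: map_append list.map transpose_apply_first transpose_apply_second append.simps)
  then show ?thesis using assms by (auto simp: cycle_list_def)
qed

text \<open>The predecessor of \<open>k\<close> is redirected to \<open>j\<close>, which closes the
  first segment on itself.\<close>

lemma cycle_list_split:
  assumes "cycle_list f (j # p @ k # q)"
  shows "cycle_list (Transposition.transpose j k \<circ> f) (j # p)"
proof -
  have "map (Transposition.transpose j k) p = p"
    using assms by (auto simp: cycle_list_def Transposition.transpose_def intro!: map_idI)
  moreover have "map f (j # p) = p @ [k]"
  proof -
    have "map f (j # p) @ map f (k # q) = (p @ [k]) @ (q @ [j])"
      using assms by (simp add: cycle_list_def)
    then show ?thesis by (subst (asm) append_eq_append_conv) auto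
  qed
  ultimately have "map (Transposition.transpose j k) (map f (j # p)) = p @ [j]"
    by simp
  then show ?thesis using assms by (auto simp: cycle_list_def)
qed

section \<open>Reversing one cycle\<close>

text \<open>Turns the orientation of one cycle around; for a Hermitian matrix this conjugates the
  product along that cycle.\<close>

definition flip_cycle :: "'n \<Rightarrow> ('n \<Rightarrow> 'n) \<Rightarrow> 'n \<Rightarrow> 'n" where
  "flip_cycle s \<sigma> x = (if x \<in> set (cycle_from \<sigma> s) then inv \<sigma> x else \<sigma> x)"

context
  fixes \<sigma> :: "'n::finite \<Rightarrow> 'n" and s :: 'n
  assumes perm: "\<sigma> permutes UNIV"
begin

lemma flip_cycle_inside: "x \<in> set (cycle_from \<sigma> s) \<Longrightarrow> flip_cycle s \<sigma> (\<sigma> x) = x"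
  using cycle_list_closed[OF cycle_from_props(1)[OF perm], of x s] permutes_inverses(2)[OF perm, of x]
  by (simp add: flip_cycle_def)

lemma flip_cycle_permutes: "flip_cycle s \<sigma> permutes UNIV"
proof -
  have "surj (flip_cycle s \<sigma>)"
    unfolding surj_def
  proof
    fix y
    show "\<exists>x. y = flip_cycle s \<sigma> x"
    proof (cases "y \<in> set (cycle_from \<sigma> s)")
      case True
      then show ?thesis using flip_cycle_inside[of y] by (intro exI[of _ "\<sigma> y"]) simp
    next
      case False
      have "inv \<sigma> y \<notin> set (cycle_from \<sigma> s)"
        using False cycle_list_closed[OF cycle_from_props(1)[OF perm], of "inv \<sigma> y" s]
          permutes_inverses(1)[OF perm, of y] by auto
      then have "flip_cycle s \<sigma> (inv \<sigma> y) = y"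
        using permutes_inverses(1)[OF perm, of y] by (simp add: flip_cycle_def)
      then show ?thesis by (intro exI[of _ "inv \<sigma> y"]) simp
    qed
  qed
  then have "bij (flip_cycle s \<sigma>)" by (simp add: bij_def finite_UNIV_surj_inj)
  then show ?thesis by (intro bij_imp_permutes) simp_all
qed

lemma cycle_from_flip_outside:
  assumes "t \<notin> set (cycle_from \<sigma> s)"
  shows "cycle_from (flip_cycle s \<sigma>) t = cycle_from \<sigma> t"
proof -
  have "x \<notin> set (cycle_from \<sigma> s)" if "x \<in> set (cycle_from \<sigma> t)" for x
    using assms that set_cycle_from_eq[OF cycle_from_props(1)[OF perm], of x]
      cycle_from_self[OF perm, of t] by auto
  then have "cycle_list (flip_cycle s \<sigma>) (cycle_from \<sigma> t)"
    by (intro cycle_list_cong[OF cycle_from_props(1)[OF perm]]) (simp add: flip_cycle_def)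
  from cycle_from_eq[OF this] show ?thesis by (simp add: cycle_from_props(2)[OF perm])
qed

lemma cycle_from_flip_same:
  assumes "cycle_from \<sigma> s = s # l"
  shows "cycle_from (flip_cycle s \<sigma>) s = s # rev l"
proof -
  have "cycle_list (inv \<sigma>) (s # rev l)"
    using cycle_list_inv[OF perm] cycle_from_props(1)[OF perm, of s] assms by simp
  then have "cycle_list (flip_cycle s \<sigma>) (s # rev l)"
    by (rule cycle_list_cong) (auto simp: flip_cycle_def assms)
  from cycle_from_eq[OF this] show ?thesis by simp
qed

text \<open>A reversal changes no cycle as a set, so the sign and the list of starting points, which
  depend only on \<open>cycle_sets\<close>, survive it.\<close>

lemma set_cycle_from_flip: "set (cycle_from (flip_cycle s \<sigma>) t) = set (cycle_from \<sigma> t)"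
proof (cases "t \<in> set (cycle_from \<sigma> s)")
  case True
  obtain l where l: "cycle_from \<sigma> s = s # l" by (rule cycle_from_Cons[OF perm])
  have "set (cycle_from (flip_cycle s \<sigma>) s) = set (cycle_from \<sigma> s)"
    using cycle_from_flip_same[OF l] l by simp
  then show ?thesis
    using True set_cycle_from_eq[OF cycle_from_props(1)[OF perm], of t s]
      set_cycle_from_eq[OF cycle_from_props(1)[OF flip_cycle_permutes], of t s] by simp
next
  case False
  then show ?thesis by (simp add: cycle_from_flip_outside)
qed

lemma cycle_sets_flip: "cycle_sets (flip_cycle s \<sigma>) = cycle_sets \<sigma>"
  unfolding cycle_sets_def cycle_from_def[symmetric] set_cycle_from_flip ..

text \<open>Being an involution, the reversal serves as its own inverse when sums over permutations
  are reindexed.\<close>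

lemma flip_cycle_flip: "flip_cycle s (flip_cycle s \<sigma>) = \<sigma>"
proof
  fix x
  show "flip_cycle s (flip_cycle s \<sigma>) x = \<sigma> x"
  proof (cases "x \<in> set (cycle_from \<sigma> s)")
    case True
    then have "inv (flip_cycle s \<sigma>) x = \<sigma> x"
      using flip_cycle_inside[of x] permutes_inv_eq[OF flip_cycle_permutes] by simp
    with True show ?thesis unfolding flip_cycle_def[of s "flip_cycle s \<sigma>"]
      by (simp add: set_cycle_from_flip)
  next
    case False
    then show ?thesis unfolding flip_cycle_def[of s "flip_cycle s \<sigma>"]
      by (simp add: set_cycle_from_flip flip_cycle_def)
  qed
qed

end

section \<open>Conjugation and cycle products\<close>

lemma cq_cnj_mult: "cq_cnj (p * q) = cq_cnj q * cq_cnj p"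
  by (simp add: coquat_eq_iff algebra_simps)

lemma cq_cnj_add: "cq_cnj (p + q) = cq_cnj p + cq_cnj q"
  by (simp add: coquat_eq_iff)

lemma cq_cnj_of_real [simp]: "cq_cnj (of_real r) = of_real r"
  by (simp add: coquat_eq_iff of_real_def)

lemma cq_cnj_cnj [simp]: "cq_cnj (cq_cnj p) = p"
  by (simp add: coquat_eq_iff)

lemma cq_cnj_zero [simp]: "cq_cnj 0 = 0" and cq_cnj_one [simp]: "cq_cnj 1 = 1"
  by (simp_all add: coquat_eq_iff)

lemma cq_cnj_sum: "cq_cnj (sum f S) = (\<Sum>x\<in>S. cq_cnj (f x))"
  by (induction S rule: infinite_finite_induct) (simp_all add: cq_cnj_add)

lemma cq_cnj_prod_list: "cq_cnj (prod_list xs) = prod_list (rev (map cq_cnj xs))"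
  by (induction xs) (simp_all add: cq_cnj_mult)

lemma add_cq_cnj: "p + cq_cnj p = of_real (Cq0 p) + of_real (Cq0 p)"
  by (simp add: coquat_eq_iff of_real_def)

text \<open>The real part behaves like a trace. This makes the real part of a cycle product
  independent of where the cycle is started.\<close>

lemma Cq0_mult_commute: "Cq0 (p * q) = Cq0 (q * p)"
  by simp

lemma hermitian_nth: "hermitian A \<Longrightarrow> cq_cnj (A $ t $ u) = A $ u $ t"
  unfolding hermitian_def conj_transpose_def by (metis vec_lambda_beta)

definition path_prod :: "coquat^'n^'n \<Rightarrow> ('n \<Rightarrow> 'n) \<Rightarrow> 'n list \<Rightarrow> coquat" where
  "path_prod A \<sigma> xs = prod_list (map (\<lambda>t. A $ t $ \<sigma> t) xs)"

lemma cycle_prod_eq: "cycle_prod A \<sigma> s = path_prod A \<sigma> (cycle_from \<sigma> s)"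
  unfolding cycle_prod_def path_prod_def cycle_from_def ..

lemma Cq0_path_prod_rotate: "Cq0 (path_prod A \<sigma> (rotate n xs)) = Cq0 (path_prod A \<sigma> xs)"
proof (induction n)
  case (Suc n)
  have "Cq0 (path_prod A \<sigma> (rotate1 ys)) = Cq0 (path_prod A \<sigma> ys)" for ys
  proof (cases ys)
    case (Cons a l)
    then show ?thesis using Cq0_mult_commute[of "path_prod A \<sigma> l" "A $ a $ \<sigma> a"]
      by (simp add: path_prod_def del: times_coquat.simps)
  qed simp
  with Suc show ?case by simp
qed simp

lemma Cq0_cycle_prod_eq:
  fixes \<sigma> :: "'n::finite \<Rightarrow> 'n"
  assumes "\<sigma> permutes UNIV" and "t \<in> set (cycle_from \<sigma> s)"
  shows "Cq0 (cycle_prod A \<sigma> t) = Cq0 (cycle_prod A \<sigma> s)"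
proof -
  obtain n where "cycle_from \<sigma> t = rotate n (cycle_from \<sigma> s)"
    by (rule cycle_from_rotate[OF cycle_from_props(1)[OF assms(1)] assms(2)])
  then show ?thesis by (simp add: cycle_prod_eq Cq0_path_prod_rotate)
qed

text \<open>With the factors indexed by pairs of consecutive elements, reversing a cycle means
  reversing a list of pairs and swapping each pair.\<close>

lemma path_prod_zip: "path_prod A \<sigma> xs = prod_list (map (\<lambda>(t, u). A $ t $ u) (zip xs (map \<sigma> xs)))"
  by (simp add: path_prod_def zip_map2 zip_same_conv_map o_def)

text \<open>Conjugation reverses the order of the factors, and the Hermitian property swaps the two
  indices of each; the result reads the cycle backwards from the same start.\<close>

lemma cq_cnj_path_prod:
  assumes "hermitian A" and "cycle_list \<sigma> (a # l)" and "cycle_list \<tau> (a # rev l)"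
  shows "cq_cnj (path_prod A \<sigma> (a # l)) = path_prod A \<tau> (a # rev l)"
proof -
  \<comment> \<open>The steps of the reversed cycle are those of the original one in opposite order,
    each taken backwards.\<close>
  have 1: "zip (a # rev l) (rev l @ [a]) = rev (zip (l @ [a]) (a # l))"
    by (simp add: zip_rev[symmetric])
  have 2: "zip (l @ [a]) (a # l) = map prod.swap (zip (a # l) (l @ [a]))"
    by (subst zip_commute) (simp add: prod.swap_def case_prod_beta)
  have "cq_cnj (path_prod A \<sigma> (a # l))
      = prod_list (rev (map (cq_cnj \<circ> (\<lambda>(t, u). A $ t $ u)) (zip (a # l) (l @ [a]))))"
    using assms(2) by (simp only: path_prod_zip cycle_list_def cq_cnj_prod_list map_map rotate1.simps)
  also have "cq_cnj \<circ> (\<lambda>(t, u). A $ t $ u) = (\<lambda>(t, u). A $ t $ u) \<circ> prod.swap"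
    using hermitian_nth[OF assms(1)] by (auto simp: fun_eq_iff)
  also have "prod_list (rev (map ((\<lambda>(t, u). A $ t $ u) \<circ> prod.swap) (zip (a # l) (l @ [a]))))
      = path_prod A \<tau> (a # rev l)"
    using assms(3) by (simp only: path_prod_zip cycle_list_def rotate1.simps 1 2 rev_map map_map)
  finally show ?thesis .
qed

lemma cycle_prod_flip:
  fixes \<sigma> :: "'n::finite \<Rightarrow> 'n"
  assumes "hermitian A" and "\<sigma> permutes UNIV"
  shows "cycle_prod A (flip_cycle s \<sigma>) s = cq_cnj (cycle_prod A \<sigma> s)"
proof -
  obtain l where l: "cycle_from \<sigma> s = s # l" by (rule cycle_from_Cons[OF assms(2)])
  show ?thesis
    using cq_cnj_path_prod[OF assms(1), of \<sigma> s l "flip_cycle s \<sigma>"]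
      cycle_from_props(1)[OF assms(2), of s]
      cycle_from_props(1)[OF flip_cycle_permutes[OF assms(2), of s], of s]
    by (simp add: cycle_prod_eq l cycle_from_flip_same[OF assms(2) l])
qed

text \<open>Stated for an arbitrary matrix because it is also applied to matrices with an
  overwritten column.\<close>

lemma cycle_prod_flip_outside:
  fixes \<sigma> :: "'n::finite \<Rightarrow> 'n"
  assumes "\<sigma> permutes UNIV" and "t \<notin> set (cycle_from \<sigma> s)"
  shows "cycle_prod A (flip_cycle s \<sigma>) t = cycle_prod A \<sigma> t"
proof -
  have "x \<notin> set (cycle_from \<sigma> s)" if "x \<in> set (cycle_from \<sigma> t)" for x
    using assms(2) that set_cycle_from_eq[OF cycle_from_props(1)[OF assms(1)], of x]
      cycle_from_self[OF assms(1), of t] by auto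
  then show ?thesis
    by (auto simp: cycle_prod_eq path_prod_def cycle_from_flip_outside[OF assms] flip_cycle_def
        intro!: arg_cong[where f=prod_list])
qed

section \<open>Row determinants from column determinants by inversion\<close>

lemma cycle_prod_inv:
  fixes \<sigma> :: "'n::finite \<Rightarrow> 'n"
  assumes "hermitian A" and "\<sigma> permutes UNIV"
  shows "cycle_prod A (inv \<sigma>) s = cq_cnj (cycle_prod A \<sigma> s)"
proof -
  obtain l where l: "cycle_from \<sigma> s = s # l" by (rule cycle_from_Cons[OF assms(2)])
  have c: "cycle_list \<sigma> (s # l)" using cycle_from_props(1)[OF assms(2), of s] l by simp
  have c': "cycle_list (inv \<sigma>) (s # rev l)" using cycle_list_inv[OF assms(2) c] .
  show ?thesis
    using cq_cnj_path_prod[OF assms(1) c c'] cycle_from_eq[OF c'] by (simp add: cycle_prod_eq l)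
qed

lemma cycle_sets_inv:
  fixes \<sigma> :: "'n::finite \<Rightarrow> 'n"
  assumes "\<sigma> permutes UNIV"
  shows "cycle_sets (inv \<sigma>) = cycle_sets \<sigma>"
proof -
  have "set (cycle_from (inv \<sigma>) s) = set (cycle_from \<sigma> s)" for s
  proof -
    obtain l where l: "cycle_from \<sigma> s = s # l" by (rule cycle_from_Cons[OF assms])
    have c: "cycle_list \<sigma> (s # l)" using cycle_from_props(1)[OF assms, of s] l by simp
    show ?thesis using cycle_from_eq[OF cycle_list_inv[OF assms c]] l by simp
  qed
  then show ?thesis unfolding cycle_sets_def cycle_from_def[symmetric] by simp
qed

text \<open>Conjugation puts the cycle products of a term in the opposite order and conjugates each.
  The conjugates are the cycle products of the inverse permutation, so reindexing by
  \<open>inv\<close> gives the row determinant.\<close>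

lemma rdet_eq_cq_cnj_cdet:
  assumes "hermitian A"
  shows "rdet i A = cq_cnj (cdet i A)"
proof -
  have sgn: "cq_cnj ((- 1) ^ m * q) = (- 1) ^ m * cq_cnj q" for m q
    by (cases "even m") (simp_all add: coquat_eq_iff)
  have "cq_cnj (cdet i A) = (\<Sum>\<sigma> | \<sigma> permutes UNIV.
     (- 1) ^ (CARD('a) - card (cycle_sets (inv \<sigma>))) *
     prod_list (map (cycle_prod A (inv \<sigma>)) (cycle_starts i (inv \<sigma>))))"
    unfolding cdet_def cq_cnj_sum
  proof (rule sum.cong[OF refl])
    fix \<sigma> :: "'a \<Rightarrow> 'a" assume "\<sigma> \<in> {\<sigma>. \<sigma> permutes UNIV}"
    then have p: "\<sigma> permutes UNIV" by simp
    have "cycle_starts i (inv \<sigma>) = cycle_starts i \<sigma>"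
      by (simp add: cycle_starts_def cycle_sets_inv[OF p])
    moreover have "cycle_prod A (inv \<sigma>) = cq_cnj \<circ> cycle_prod A \<sigma>"
      using cycle_prod_inv[OF assms p] by (simp add: fun_eq_iff)
    ultimately show "cq_cnj ((- 1) ^ (CARD('a) - card (cycle_sets \<sigma>)) *
        prod_list (map (cycle_prod A \<sigma>) (rev (cycle_starts i \<sigma>)))) =
      (- 1) ^ (CARD('a) - card (cycle_sets (inv \<sigma>))) *
        prod_list (map (cycle_prod A (inv \<sigma>)) (cycle_starts i (inv \<sigma>)))"
      by (simp add: sgn cq_cnj_prod_list cycle_sets_inv[OF p] rev_map)
  qed
  also have "\<dots> = rdet i A"
    unfolding rdet_def
    by (rule sum.reindex_bij_witness[of _ inv inv])
      (auto simp: permutes_inv permutes_inv_inv)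
  finally show ?thesis ..
qed

section \<open>Column determinants with real cycle weights\<close>

lemma Min_cycle_in:
  fixes \<sigma> :: "'n::{finite,linorder} \<Rightarrow> 'n"
  assumes "\<sigma> permutes UNIV" and "C \<in> cycle_sets \<sigma>"
  shows "Min C \<in> C"
  using cycle_sets_nonempty[OF assms] by simp

lemma inj_on_Min_cycle_sets:
  fixes \<sigma> :: "'n::{finite,linorder} \<Rightarrow> 'n"
  assumes "\<sigma> permutes UNIV"
  shows "inj_on Min (cycle_sets \<sigma>)"
proof (rule inj_onI)
  fix C D assume C: "C \<in> cycle_sets \<sigma>" and D: "D \<in> cycle_sets \<sigma>" and "Min C = Min D"
  then show "C = D"
    using cycle_sets_eq_set_cycle_from[OF assms C Min_cycle_in[OF assms C]]
      cycle_sets_eq_set_cycle_from[OF assms D Min_cycle_in[OF assms D]] by simp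
qed

text \<open>The tail of \<open>cycle_starts j \<sigma>\<close>, belonging to the cycles that avoid
  \<open>j\<close>.\<close>

definition other_starts :: "'n::{finite,linorder} \<Rightarrow> ('n \<Rightarrow> 'n) \<Rightarrow> 'n list" where
  "other_starts j \<sigma> = sorted_list_of_set (Min ` {C \<in> cycle_sets \<sigma>. j \<notin> C})"

lemma distinct_other_starts [simp]: "distinct (other_starts j \<sigma>)"
  by (simp add: other_starts_def)

lemma set_other_starts: "set (other_starts j \<sigma>) = Min ` {C \<in> cycle_sets \<sigma>. j \<notin> C}"
  by (simp add: other_starts_def)

lemma other_starts_cycle:
  fixes \<sigma> :: "'n::{finite,linorder} \<Rightarrow> 'n"
  assumes "\<sigma> permutes UNIV" and "s \<in> set (other_starts j \<sigma>)"
  obtains C where "C \<in> cycle_sets \<sigma>" "j \<notin> C" "s = Min C" "C = set (cycle_from \<sigma> s)"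
proof -
  obtain C where C: "C \<in> cycle_sets \<sigma>" "j \<notin> C" "s = Min C"
    using assms(2) by (auto simp: set_other_starts)
  show thesis
    using that[OF C] cycle_sets_eq_set_cycle_from[OF assms(1) C(1) Min_cycle_in[OF assms(1) C(1)]] C(3)
    by metis
qed

text \<open>Different starting points lie in different cycles, so flipping the cycle through
  \<open>s\<close> affects neither the product through \<open>j\<close> nor those at the other
  starting points.\<close>

lemma other_starts_disjoint:
  fixes \<sigma> :: "'n::{finite,linorder} \<Rightarrow> 'n"
  assumes "\<sigma> permutes UNIV" and "s \<in> set (other_starts j \<sigma>)"
  shows "j \<notin> set (cycle_from \<sigma> s)"
    and "t \<in> set (other_starts j \<sigma>) \<Longrightarrow> t \<noteq> s \<Longrightarrow> t \<notin> set (cycle_from \<sigma> s)"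
proof -
  obtain C where C: "C \<in> cycle_sets \<sigma>" "j \<notin> C" "s = Min C" "C = set (cycle_from \<sigma> s)"
    by (rule other_starts_cycle[OF assms])
  show "j \<notin> set (cycle_from \<sigma> s)" using C(2,4) by simp
  assume t: "t \<in> set (other_starts j \<sigma>)" "t \<noteq> s"
  obtain D where D: "D \<in> cycle_sets \<sigma>" "j \<notin> D" "t = Min D" "D = set (cycle_from \<sigma> t)"
    by (rule other_starts_cycle[OF assms(1) t(1)])
  show "t \<notin> set (cycle_from \<sigma> s)"
  proof
    assume "t \<in> set (cycle_from \<sigma> s)"
    then have "D = C"
      using set_cycle_from_eq[OF cycle_from_props(1)[OF assms(1)], of t s] C(4) D(4) by simp
    then show False using t(2) C(3) D(3) by simp
  qed
qed

section \<open>Signs and real weights of cycles\<close>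

definition cycle_sign :: "('n::finite \<Rightarrow> 'n) \<Rightarrow> real" where
  "cycle_sign \<sigma> = (- 1) ^ (CARD('n) - card (cycle_sets \<sigma>))"

text \<open>\<open>Min C\<close> merely selects a starting point; the real part is the same for
  every element of the cycle, as \<open>cycle_weight_cycle_from\<close> shows.\<close>

definition cycle_weight :: "coquat^'n::{finite,linorder}^'n::{finite,linorder} \<Rightarrow> ('n \<Rightarrow> 'n) \<Rightarrow> 'n set \<Rightarrow> real" where
  "cycle_weight A \<sigma> C = Cq0 (cycle_prod A \<sigma> (Min C))"

lemma cycle_weight_cycle_from:
  fixes \<sigma> :: "'n::{finite,linorder} \<Rightarrow> 'n"
  assumes "\<sigma> permutes UNIV"
  shows "cycle_weight A \<sigma> (set (cycle_from \<sigma> s)) = Cq0 (cycle_prod A \<sigma> s)"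
  unfolding cycle_weight_def
  using Min_cycle_in[OF assms set_cycle_from_in_cycle_sets, of s]
  by (rule Cq0_cycle_prod_eq[OF assms])

lemma cycle_sign_flip:
  "\<sigma> permutes UNIV \<Longrightarrow> cycle_sign (flip_cycle s \<sigma>) = cycle_sign \<sigma>"
  by (simp add: cycle_sign_def cycle_sets_flip)

lemma other_starts_flip:
  "\<sigma> permutes UNIV \<Longrightarrow> other_starts j (flip_cycle s \<sigma>) = other_starts j \<sigma>"
  by (simp add: other_starts_def cycle_sets_flip)

lemma cycle_weight_flip:
  fixes \<sigma> :: "'n::{finite,linorder} \<Rightarrow> 'n"
  assumes "\<sigma> permutes UNIV" "C \<in> cycle_sets \<sigma>" "s \<notin> C"
  shows "cycle_weight A (flip_cycle s \<sigma>) C = cycle_weight A \<sigma> C"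
proof -
  have "Min C \<notin> set (cycle_from \<sigma> s)"
  proof
    assume m: "Min C \<in> set (cycle_from \<sigma> s)"
    have "C = set (cycle_from \<sigma> (Min C))"
      using cycle_sets_eq_set_cycle_from[OF assms(1,2)] Min_cycle_in[OF assms(1,2)] by simp
    also have "\<dots> = set (cycle_from \<sigma> s)"
      using set_cycle_from_eq[OF cycle_from_props(1)[OF assms(1)] m] .
    finally show False using assms(3) cycle_from_self[OF assms(1), of s] by simp
  qed
  then show ?thesis
    by (simp add: cycle_weight_def cycle_prod_flip_outside[OF assms(1)])
qed

text \<open>Averaging principle: \<open>H\<close> is a summand with the cycle product at
  \<open>s\<close> left open. Reindexing by the flip replaces that product by its conjugate, and
  adding both versions leaves twice the real part.\<close>

lemma sum_flip_cycle:
  fixes A :: "coquat^'n::finite^'n::finite" and H :: "('n \<Rightarrow> 'n) \<Rightarrow> coquat \<Rightarrow> coquat"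
  assumes "hermitian A"
    and perm: "\<And>\<sigma>. \<sigma> \<in> T \<Longrightarrow> \<sigma> permutes UNIV"
    and flip: "\<And>\<sigma>. \<sigma> \<in> T \<Longrightarrow> flip_cycle s \<sigma> \<in> T"
    and H_flip: "\<And>\<sigma> p. \<sigma> \<in> T \<Longrightarrow> H (flip_cycle s \<sigma>) p = H \<sigma> p"
    and H_add: "\<And>\<sigma> p q. \<sigma> \<in> T \<Longrightarrow> H \<sigma> (p + q) = H \<sigma> p + H \<sigma> q"
  shows "(\<Sum>\<sigma>\<in>T. H \<sigma> (cycle_prod A \<sigma> s)) = (\<Sum>\<sigma>\<in>T. H \<sigma> (of_real (Cq0 (cycle_prod A \<sigma> s))))"
    (is "?S = ?R")
proof -
  have "?S = (\<Sum>\<sigma>\<in>T. H \<sigma> (cq_cnj (cycle_prod A \<sigma> s)))"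
    by (rule sum.reindex_bij_witness[of _ "flip_cycle s" "flip_cycle s"])
      (simp_all add: perm flip flip_cycle_flip H_flip cycle_prod_flip[OF assms(1)])
  then have "?S + ?S = (\<Sum>\<sigma>\<in>T. H \<sigma> (cycle_prod A \<sigma> s) + H \<sigma> (cq_cnj (cycle_prod A \<sigma> s)))"
    by (simp add: sum.distrib)
  also have "\<dots> = (\<Sum>\<sigma>\<in>T. H \<sigma> (of_real (Cq0 (cycle_prod A \<sigma> s))) + H \<sigma> (of_real (Cq0 (cycle_prod A \<sigma> s))))"
    by (intro sum.cong refl) (simp only: H_add[symmetric] add_cq_cnj)
  also have "\<dots> = ?R + ?R"
    by (simp add: sum.distrib)
  \<comment> \<open>The doubling is cancelled in each of the four real coordinates.\<close>
  finally show ?thesis by (simp add: coquat_eq_iff)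
qed

text \<open>Distinctness makes \<open>s\<close> occur exactly once, so the product is additive in
  that factor; this supplies the additivity required by \<open>sum_flip_cycle\<close>.\<close>

lemma prod_list_map_upd_add:
  fixes f :: "'a \<Rightarrow> 'b::semiring_1"
  assumes "distinct xs" and "s \<in> set xs"
  shows "prod_list (map (f(s := p + q)) xs) = prod_list (map (f(s := p)) xs) + prod_list (map (f(s := q)) xs)"
proof -
  obtain us vs where xs: "xs = us @ s # vs" using assms(2) by (meson split_list)
  have m: "map (f(s := r)) us = map f us" "map (f(s := r)) vs = map f vs" for r
    using assms(1) xs by auto
  show ?thesis by (simp add: xs m algebra_simps)
qed

lemma prod_list_of_real: "prod_list (map (\<lambda>x. of_real (f x)) xs) = (of_real (prod_list (map f xs)) :: coquat)"
  by (induction xs) simp_all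

text \<open>Cycles avoiding \<open>j\<close> never use column \<open>j\<close>, so their products in
  \<open>B\<close> are those of \<open>A\<close>, and averaging makes them real one at a time. Real
  factors commute, and only the cycle through \<open>j\<close> still sees the entries of
  \<open>B\<close>.\<close>

lemma cdet_real_weights:
  fixes A B :: "coquat^'n::{finite,linorder}^'n::{finite,linorder}"
  assumes "hermitian A" and B: "\<And>t l. l \<noteq> j \<Longrightarrow> B $ t $ l = A $ t $ l"
  shows "cdet j B = (\<Sum>\<sigma> | \<sigma> permutes UNIV.
    (cycle_sign \<sigma> * (\<Prod>C | C \<in> cycle_sets \<sigma> \<and> j \<notin> C. cycle_weight A \<sigma> C)) *\<^sub>R cycle_prod B \<sigma> j)"
proof -
  \<comment> \<open>\<open>S\<close> collects the starting points whose products have already been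
    replaced by real parts: \<open>G {}\<close> is the summand of the determinant,
    \<open>G UNIV\<close> the fully averaged one.\<close>
  define f where "f S \<sigma> m = (if m \<in> S then of_real (Cq0 (cycle_prod A \<sigma> m)) else cycle_prod A \<sigma> m)"
    for S :: "'n set" and \<sigma> m
  define G where "G S \<sigma> = cycle_sign \<sigma> *\<^sub>R (prod_list (map (f S \<sigma>) (rev (other_starts j \<sigma>))) * cycle_prod B \<sigma> j)"
    for S \<sigma>
  have average: "(\<Sum>\<sigma> | \<sigma> permutes UNIV. G {} \<sigma>) = (\<Sum>\<sigma> | \<sigma> permutes UNIV. G S \<sigma>)" if "finite S" for S
    using that
  proof (induction S)
    case (insert s S)
    let ?P = "{\<sigma> :: 'n \<Rightarrow> 'n. \<sigma> permutes UNIV}"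
    \<comment> \<open>If \<open>s\<close> is no starting point for \<open>\<sigma>\<close>,
      enlarging \<open>S\<close> changes nothing; only the remaining permutations are
      averaged.\<close>
    let ?T = "{\<sigma> \<in> ?P. s \<in> set (other_starts j \<sigma>)}" and ?T' = "{\<sigma> \<in> ?P. s \<notin> set (other_starts j \<sigma>)}"
    have split: "(\<Sum>\<sigma>\<in>?P. F \<sigma>) = (\<Sum>\<sigma>\<in>?T. F \<sigma>) + (\<Sum>\<sigma>\<in>?T'. F \<sigma>)" for F :: "_ \<Rightarrow> coquat"
      by (subst sum.union_disjoint[symmetric]) (auto intro: sum.cong)
    have T': "G S \<sigma> = G (insert s S) \<sigma>" if "\<sigma> \<in> ?T'" for \<sigma>
    proof -
      have "map (f S \<sigma>) (rev (other_starts j \<sigma>)) = map (f (insert s S) \<sigma>) (rev (other_starts j \<sigma>))"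
        using that by (auto simp: f_def)
      then show ?thesis by (simp only: G_def)
    qed
    \<comment> \<open>The factor at \<open>s\<close> becomes the free variable of the averaging
      principle.\<close>
    define H where "H \<sigma> p = cycle_sign \<sigma> *\<^sub>R
      (prod_list (map ((f S \<sigma>)(s := p)) (rev (other_starts j \<sigma>))) * cycle_prod B \<sigma> j)" for \<sigma> p
    have "(f S \<sigma>)(s := cycle_prod A \<sigma> s) = f S \<sigma>"
      "(f S \<sigma>)(s := of_real (Cq0 (cycle_prod A \<sigma> s))) = f (insert s S) \<sigma>" for \<sigma>
      using insert.hyps by (auto simp: f_def fun_eq_iff)
    then have HG: "H \<sigma> (cycle_prod A \<sigma> s) = G S \<sigma>"
      "H \<sigma> (of_real (Cq0 (cycle_prod A \<sigma> s))) = G (insert s S) \<sigma>" for \<sigma>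
      by (simp_all only: H_def G_def)
    have "(\<Sum>\<sigma>\<in>?T. H \<sigma> (cycle_prod A \<sigma> s)) = (\<Sum>\<sigma>\<in>?T. H \<sigma> (of_real (Cq0 (cycle_prod A \<sigma> s))))"
    proof (rule sum_flip_cycle[OF assms(1)])
      fix \<sigma> assume \<sigma>: "\<sigma> \<in> ?T"
      then show p: "\<sigma> permutes UNIV" by simp
      show "flip_cycle s \<sigma> \<in> ?T"
        using \<sigma> by (simp add: flip_cycle_permutes other_starts_flip)
      have s: "s \<in> set (other_starts j \<sigma>)" using \<sigma> by simp
      have "((f S (flip_cycle s \<sigma>))(s := q)) m = ((f S \<sigma>)(s := q)) m"
        if "m \<in> set (other_starts j \<sigma>)" for m q
        using other_starts_disjoint(2)[OF p s that]
        by (simp add: f_def cycle_prod_flip_outside[OF p])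
      then have "map ((f S (flip_cycle s \<sigma>))(s := q)) (rev (other_starts j \<sigma>)) =
          map ((f S \<sigma>)(s := q)) (rev (other_starts j \<sigma>))" for q
        by simp
      then show "H (flip_cycle s \<sigma>) q = H \<sigma> q" for q
        using cycle_prod_flip_outside[OF p other_starts_disjoint(1)[OF p s]]
        by (simp only: H_def cycle_sign_flip[OF p] other_starts_flip[OF p])
      show "H \<sigma> (q + q') = H \<sigma> q + H \<sigma> q'" for q q'
        using s by (simp add: H_def prod_list_map_upd_add distrib_right scaleR_add_right del: fun_upd_apply)
    qed
    then have "(\<Sum>\<sigma>\<in>?T. G S \<sigma>) = (\<Sum>\<sigma>\<in>?T. G (insert s S) \<sigma>)"
      by (simp only: HG)
    moreover have "(\<Sum>\<sigma>\<in>?T'. G S \<sigma>) = (\<Sum>\<sigma>\<in>?T'. G (insert s S) \<sigma>)"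
      by (rule sum.cong[OF refl T'])
    ultimately have "(\<Sum>\<sigma>\<in>?P. G S \<sigma>) = (\<Sum>\<sigma>\<in>?P. G (insert s S) \<sigma>)"
      by (simp only: split)
    with insert.IH show ?case by simp
  qed simp
  have "cdet j B = (\<Sum>\<sigma> | \<sigma> permutes UNIV. G {} \<sigma>)"
    unfolding cdet_def
  proof (rule sum.cong[OF refl])
    fix \<sigma> :: "'n \<Rightarrow> 'n" assume "\<sigma> \<in> {\<sigma>. \<sigma> permutes UNIV}"
    then have p: "\<sigma> permutes UNIV" by simp
    have "cycle_prod B \<sigma> m = f {} \<sigma> m" if m: "m \<in> set (other_starts j \<sigma>)" for m
    proof -
      have "\<sigma> t \<noteq> j" if "t \<in> set (cycle_from \<sigma> m)" for t
        using other_starts_disjoint(1)[OF p m] cycle_list_closed[OF cycle_from_props(1)[OF p] that]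
        by auto
      then show ?thesis
        by (auto simp: f_def cycle_prod_eq path_prod_def B intro!: arg_cong[where f=prod_list])
    qed
    then have "prod_list (map (cycle_prod B \<sigma>) (rev (other_starts j \<sigma>))) =
        prod_list (map (f {} \<sigma>) (rev (other_starts j \<sigma>)))"
      by (intro arg_cong[where f=prod_list]) simp
    moreover have "cycle_starts j \<sigma> = j # other_starts j \<sigma>"
      by (simp add: cycle_starts_def other_starts_def)
    moreover have "(- 1) ^ m * q = (- 1) ^ m *\<^sub>R q" for m and q :: coquat
      by (cases "even m") simp_all
    ultimately show "(- 1) ^ (CARD('n) - card (cycle_sets \<sigma>)) *
        prod_list (map (cycle_prod B \<sigma>) (rev (cycle_starts j \<sigma>))) = G {} \<sigma>"
      by (simp add: G_def cycle_sign_def)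
  qed
  also have "\<dots> = (\<Sum>\<sigma> | \<sigma> permutes UNIV. G UNIV \<sigma>)"
    by (rule average) simp
  also have "\<dots> = (\<Sum>\<sigma> | \<sigma> permutes UNIV.
    (cycle_sign \<sigma> * (\<Prod>C | C \<in> cycle_sets \<sigma> \<and> j \<notin> C. cycle_weight A \<sigma> C)) *\<^sub>R cycle_prod B \<sigma> j)"
  proof (rule sum.cong[OF refl])
    fix \<sigma> :: "'n \<Rightarrow> 'n" assume "\<sigma> \<in> {\<sigma>. \<sigma> permutes UNIV}"
    then have p: "\<sigma> permutes UNIV" by simp
    have "prod_list (map (f UNIV \<sigma>) (rev (other_starts j \<sigma>))) =
        of_real (prod_list (map (\<lambda>m. Cq0 (cycle_prod A \<sigma> m)) (rev (other_starts j \<sigma>))))"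
      unfolding prod_list_of_real[symmetric] by (intro arg_cong[where f=prod_list]) (simp add: f_def)
    \<comment> \<open>Among reals the order of the list no longer matters.\<close>
    also have "prod_list (map (\<lambda>m. Cq0 (cycle_prod A \<sigma> m)) (rev (other_starts j \<sigma>))) =
        (\<Prod>m\<in>set (other_starts j \<sigma>). Cq0 (cycle_prod A \<sigma> m))"
      using prod.distinct_set_conv_list[of "rev (other_starts j \<sigma>)"
          "\<lambda>m. Cq0 (cycle_prod A \<sigma> m)"] by simp
    also have "\<dots> = (\<Prod>C | C \<in> cycle_sets \<sigma> \<and> j \<notin> C. cycle_weight A \<sigma> C)"
      unfolding set_other_starts
      by (subst prod.reindex) (auto intro: inj_on_subset[OF inj_on_Min_cycle_sets[OF p]] simp: cycle_weight_def)
    finally show "G UNIV \<sigma> = (cycle_sign \<sigma> * (\<Prod>C | C \<in> cycle_sets \<sigma> \<and> j \<notin> C. cycle_weight A \<sigma> C)) *\<^sub>R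
        cycle_prod B \<sigma> j"
      by (simp add: G_def of_real_def)
  qed
  finally show ?thesis .
qed

text \<open>The common value of all row and column determinants of a Hermitian matrix, written with
  real parts so that no index and no order of factors is singled out.\<close>

definition moore_det :: "coquat^'n::{finite,linorder}^'n::{finite,linorder} \<Rightarrow> real" where
  "moore_det A = (\<Sum>\<sigma> | \<sigma> permutes (UNIV :: 'n::{finite,linorder} set).
     cycle_sign \<sigma> * (\<Prod>C\<in>cycle_sets \<sigma>. cycle_weight A \<sigma> C))"

lemma prod_cycle_sets:
  fixes \<sigma> :: "'n::{finite,linorder} \<Rightarrow> 'n"
  assumes "\<sigma> permutes UNIV"
  shows "(\<Prod>C\<in>cycle_sets \<sigma>. cycle_weight A \<sigma> C) =
    Cq0 (cycle_prod A \<sigma> j) * (\<Prod>C | C \<in> cycle_sets \<sigma> \<and> j \<notin> C. cycle_weight A \<sigma> C)"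
  using cycle_from_self[OF assms, of j]
  by (subst cycle_sets_insert[OF assms, of j], subst prod.insert)
    (simp_all add: cycle_weight_cycle_from[OF assms])

text \<open>The case \<open>B = A\<close> of \<open>cdet_real_weights\<close>, followed by one more
  averaging over the orientation of the cycle through \<open>j\<close>; its real part completes the
  product over all cycles.\<close>

lemma cdet_hermitian:
  fixes A :: "coquat^'n::{finite,linorder}^'n::{finite,linorder}"
  assumes "hermitian A"
  shows "cdet j A = of_real (moore_det A)"
proof -
  define c where "c \<sigma> = cycle_sign \<sigma> * (\<Prod>C | C \<in> cycle_sets \<sigma> \<and> j \<notin> C. cycle_weight A \<sigma> C)" for \<sigma>
  have "cdet j A = (\<Sum>\<sigma> | \<sigma> permutes UNIV. c \<sigma> *\<^sub>R cycle_prod A \<sigma> j)"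
    unfolding c_def by (rule cdet_real_weights[OF assms refl])
  also have "\<dots> = (\<Sum>\<sigma> | \<sigma> permutes UNIV. c \<sigma> *\<^sub>R of_real (Cq0 (cycle_prod A \<sigma> j)))"
  proof (rule sum_flip_cycle[OF assms])
    fix \<sigma> :: "'n \<Rightarrow> 'n" assume "\<sigma> \<in> {\<sigma>. \<sigma> permutes UNIV}"
    then have p: "\<sigma> permutes UNIV" by simp
    have "c (flip_cycle j \<sigma>) = c \<sigma>"
      unfolding c_def cycle_sets_flip[OF p] cycle_sign_flip[OF p]
      by (simp add: cycle_weight_flip[OF p])
    then show "c (flip_cycle j \<sigma>) *\<^sub>R q = c \<sigma> *\<^sub>R q" for q :: coquat by simp
  qed (simp_all add: flip_cycle_permutes scaleR_add_right)
  also have "\<dots> = (\<Sum>\<sigma> | \<sigma> permutes (UNIV :: 'n set).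
      of_real (cycle_sign \<sigma> * (\<Prod>C\<in>cycle_sets \<sigma>. cycle_weight A \<sigma> C)))"
    by (intro sum.cong refl) (simp add: c_def prod_cycle_sets[where j=j] of_real_def)
  finally show ?thesis by (simp only: moore_det_def of_real_sum)
qed

text \<open>All column determinants equal this real number and the row determinants are its
  conjugate; injectivity of \<open>of_real\<close> makes the described value unique.\<close>

lemma hdet_hermitian:
  fixes A :: "coquat^'n::{finite,linorder}^'n::{finite,linorder}"
  assumes "hermitian A"
  shows "hdet A = moore_det A"
  unfolding hdet_def rdet_eq_cq_cnj_cdet[OF assms] cdet_hermitian[OF assms]
  by (rule the_equality) simp_all

section \<open>Repeated columns\<close>

lemma transpose_comp_cancel: "Transposition.transpose j k \<circ> (Transposition.transpose j k \<circ> f) = f"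
  by (simp add: fun_eq_iff)

lemma cycle_list_transpose_comp:
  assumes "cycle_list f xs" and "j \<notin> set xs" and "k \<notin> set xs"
  shows "cycle_list (Transposition.transpose j k \<circ> f) xs"
proof (rule cycle_list_cong[OF assms(1)])
  fix x assume "x \<in> set xs"
  from cycle_list_closed[OF assms(1) this] have "f x \<noteq> j" "f x \<noteq> k" using assms(2,3) by auto
  then show "f x = (Transposition.transpose j k \<circ> f) x" by (simp add: transpose_apply_other)
qed

lemma transpose_comp_permutes:
  "\<sigma> permutes UNIV \<Longrightarrow> Transposition.transpose j k \<circ> \<sigma> permutes UNIV"
  by (intro permutes_compose permutes_swap_id) simp_all

text \<open>Composing with the transposition cuts the cycle through \<open>j\<close> just before
  \<open>k\<close>.\<close>

lemma cycle_from_split: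
  fixes \<sigma> :: "'n::finite \<Rightarrow> 'n"
  assumes "\<sigma> permutes UNIV" and "j \<noteq> k" and "k \<in> set (cycle_from \<sigma> j)"
  shows "k \<notin> set (cycle_from (Transposition.transpose j k \<circ> \<sigma>) j)"
proof -
  obtain l where l: "cycle_from \<sigma> j = j # l" by (rule cycle_from_Cons[OF assms(1)])
  with assms obtain p q where "l = p @ k # q" using split_list[of k l] by auto
  with l have c: "cycle_list \<sigma> (j # p @ k # q)" using cycle_from_props(1)[OF assms(1), of j] by simp
  have "cycle_from (Transposition.transpose j k \<circ> \<sigma>) j = j # p"
    using cycle_from_eq[OF cycle_list_split[OF c]] by simp
  then show ?thesis using c assms(2) by (auto simp: cycle_list_def)
qed

section \<open>Joining the cycles of two indices by a transposition\<close>

context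
  fixes \<sigma> \<tau> :: "'n::{finite,linorder} \<Rightarrow> 'n" and j k :: 'n
  assumes perm: "\<sigma> permutes UNIV" and k: "k \<notin> set (cycle_from \<sigma> j)"
  defines "\<tau> \<equiv> Transposition.transpose j k \<circ> \<sigma>"
begin

lemma cycles_disjoint: "set (cycle_from \<sigma> j) \<inter> set (cycle_from \<sigma> k) = {}"
proof (rule ccontr)
  assume "set (cycle_from \<sigma> j) \<inter> set (cycle_from \<sigma> k) \<noteq> {}"
  then obtain x where x: "x \<in> set (cycle_from \<sigma> j)" "x \<in> set (cycle_from \<sigma> k)" by auto
  have "set (cycle_from \<sigma> j) = set (cycle_from \<sigma> k)"
    using set_cycle_from_eq[OF cycle_from_props(1)[OF perm] x(1)]
      set_cycle_from_eq[OF cycle_from_props(1)[OF perm] x(2)] by simp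
  then show False using k cycle_from_self[OF perm, of k] by simp
qed

lemma cycle_from_merge: "cycle_from \<tau> j = cycle_from \<sigma> j @ cycle_from \<sigma> k"
proof -
  obtain p where p: "cycle_from \<sigma> j = j # p" by (rule cycle_from_Cons[OF perm])
  obtain q where q: "cycle_from \<sigma> k = k # q" by (rule cycle_from_Cons[OF perm])
  have "cycle_list \<tau> (j # p @ k # q)"
    unfolding \<tau>_def
    using cycle_list_merge cycle_from_props(1)[OF perm, of j] cycle_from_props(1)[OF perm, of k]
      cycles_disjoint unfolding p q .
  from cycle_from_eq[OF this] show ?thesis by (simp add: p q)
qed

lemma merge_permutes: "\<tau> permutes UNIV"
  unfolding \<tau>_def by (rule transpose_comp_permutes[OF perm])

text \<open>The joined cycle contains both \<open>j\<close> and \<open>k\<close>; every other cycle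
  is untouched by the transposition.\<close>

lemma cycle_sets_merge:
  "{C \<in> cycle_sets \<tau>. j \<notin> C} = {C \<in> cycle_sets \<sigma>. j \<notin> C \<and> k \<notin> C}"
proof (intro equalityI subsetI)
  fix C assume "C \<in> {C \<in> cycle_sets \<sigma>. j \<notin> C \<and> k \<notin> C}"
  then show "C \<in> {C \<in> cycle_sets \<tau>. j \<notin> C}"
    using cycle_list_transpose_comp[of \<sigma> _ j k]
    by (auto simp: cycle_sets_eq[OF perm] cycle_sets_eq[OF merge_permutes] \<tau>_def[symmetric])
next
  fix C assume C: "C \<in> {C \<in> cycle_sets \<tau>. j \<notin> C}"
  have "k \<notin> C"
  proof
    assume "k \<in> C"
    then have "C = set (cycle_from \<tau> k)"
      using C cycle_sets_eq_set_cycle_from[OF merge_permutes] by simp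
    also have "\<dots> = set (cycle_from \<tau> j)"
      using cycle_from_self[OF perm, of k]
      by (intro set_cycle_from_eq[OF cycle_from_props(1)[OF merge_permutes]]) (simp add: cycle_from_merge)
    finally show False using C cycle_from_self[OF merge_permutes, of j] by simp
  qed
  \<comment> \<open>Composing twice gives \<open>\<sigma>\<close> back, so the same transfer of
    cycles works in this direction too.\<close>
  moreover have "Transposition.transpose j k \<circ> \<tau> = \<sigma>"
    by (simp add: \<tau>_def transpose_comp_cancel)
  ultimately show "C \<in> {C \<in> cycle_sets \<sigma>. j \<notin> C \<and> k \<notin> C}"
    using C cycle_list_transpose_comp[of \<tau> _ j k]
    by (auto simp: cycle_sets_eq[OF perm] cycle_sets_eq[OF merge_permutes])
qed

lemma cycle_sets_without_j:
  "{C \<in> cycle_sets \<sigma>. j \<notin> C} = insert (set (cycle_from \<sigma> k)) {C \<in> cycle_sets \<sigma>. j \<notin> C \<and> k \<notin> C}"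
proof -
  have "j \<notin> set (cycle_from \<sigma> k)" using cycles_disjoint cycle_from_self[OF perm, of j] by auto
  then show ?thesis using cycle_sets_insert[OF perm, of k] by auto
qed

text \<open>Joining lowers the number of cycles by one, counted by setting aside the cycle through
  \<open>j\<close> and then the one through \<open>k\<close>.\<close>

lemma cycle_sign_merge: "cycle_sign \<tau> = - cycle_sign \<sigma>"
proof -
  have "card (cycle_sets \<sigma>) = Suc (card {C \<in> cycle_sets \<sigma>. j \<notin> C})"
    using cycle_from_self[OF perm, of j] by (subst cycle_sets_insert[OF perm, of j]) simp
  also have "card {C \<in> cycle_sets \<sigma>. j \<notin> C} = Suc (card {C \<in> cycle_sets \<tau>. j \<notin> C})"
    using cycle_from_self[OF perm, of k] unfolding cycle_sets_without_j cycle_sets_merge by simp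
  also have "\<dots> = card (cycle_sets \<tau>)"
    using cycle_from_self[OF merge_permutes, of j] by (subst (2) cycle_sets_insert[OF merge_permutes, of j]) simp
  finally have "card (cycle_sets \<sigma>) = Suc (card (cycle_sets \<tau>))" .
  then have "CARD('n) - card (cycle_sets \<tau>) = Suc (CARD('n) - card (cycle_sets \<sigma>))"
    using card_cycle_sets_le[of \<sigma>] by simp
  then show ?thesis by (simp add: cycle_sign_def)
qed

lemma cycle_weight_merge:
  assumes "C \<in> cycle_sets \<sigma>" "j \<notin> C" "k \<notin> C"
  shows "cycle_weight A \<tau> C = cycle_weight A \<sigma> C"
proof -
  let ?m = "Min C"
  have C: "C = set (cycle_from \<sigma> ?m)"
    using cycle_sets_eq_set_cycle_from[OF perm assms(1)] Min_cycle_in[OF perm assms(1)] by simp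
  then have "cycle_list \<tau> (cycle_from \<sigma> ?m)"
    unfolding \<tau>_def using assms
    by (intro cycle_list_transpose_comp cycle_from_props[OF perm]) simp_all
  from cycle_from_eq[OF this] have 1: "cycle_from \<tau> ?m = cycle_from \<sigma> ?m"
    by (simp add: cycle_from_props(2)[OF perm])
  have "\<tau> x = \<sigma> x" if "x \<in> set (cycle_from \<sigma> ?m)" for x
  proof -
    have "\<sigma> x \<in> C" using C cycle_list_closed[OF cycle_from_props(1)[OF perm] that] by simp
    then show ?thesis using assms by (auto simp: \<tau>_def intro!: transpose_apply_other)
  qed
  then have "map (\<lambda>t. A $ t $ \<tau> t) (cycle_from \<sigma> ?m) = map (\<lambda>t. A $ t $ \<sigma> t) (cycle_from \<sigma> ?m)"
    by simp
  then show ?thesis by (simp only: cycle_weight_def cycle_prod_eq path_prod_def 1)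
qed

text \<open>Joining redirects the arrow into \<open>j\<close> to \<open>k\<close> and vice versa.
  Column \<open>j\<close> of \<open>B\<close> is a copy of column \<open>k\<close> of
  \<open>A\<close>, so this exchange does not alter the factors.\<close>

lemma cycle_prod_merge:
  assumes "j \<noteq> k" and B: "\<And>t l. B $ t $ l = A $ t $ (if l = j then k else l)"
  shows "cycle_prod B \<tau> j = cycle_prod B \<sigma> j * cycle_prod A \<sigma> k"
proof -
  have "B $ t $ \<tau> t = B $ t $ \<sigma> t" if "t \<in> set (cycle_from \<sigma> j)" for t
  proof -
    have "\<sigma> t \<noteq> k" using k cycle_list_closed[OF cycle_from_props(1)[OF perm] that] by auto
    then show ?thesis using \<open>j \<noteq> k\<close> by (auto simp: B \<tau>_def Transposition.transpose_def)
  qed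
  moreover have "B $ t $ \<tau> t = A $ t $ \<sigma> t" if "t \<in> set (cycle_from \<sigma> k)" for t
  proof -
    have "\<sigma> t \<noteq> j"
      using cycles_disjoint cycle_from_self[OF perm, of j]
        cycle_list_closed[OF cycle_from_props(1)[OF perm] that] by auto
    then show ?thesis using \<open>j \<noteq> k\<close> by (auto simp: B \<tau>_def Transposition.transpose_def)
  qed
  ultimately have "map (\<lambda>t. B $ t $ \<tau> t) (cycle_from \<tau> j) =
      map (\<lambda>t. B $ t $ \<sigma> t) (cycle_from \<sigma> j) @ map (\<lambda>t. A $ t $ \<sigma> t) (cycle_from \<sigma> k)"
    unfolding cycle_from_merge by simp
  then show ?thesis by (simp only: cycle_prod_eq path_prod_def prod_list.append)
qed

end

lemma cdet_repeated_column:
  fixes A :: "coquat^'n::{finite,linorder}^'n::{finite,linorder}"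
  assumes "hermitian A" and "j \<noteq> k"
  shows "cdet j (replace_col A j (column k A)) = 0"
proof -
  define B where "B = replace_col A j (column k A)"
  have B: "B $ t $ l = A $ t $ (if l = j then k else l)" for t l
    by (simp add: B_def replace_col_def column_def)
  define F where "F \<sigma> = (cycle_sign \<sigma> * (\<Prod>C | C \<in> cycle_sets \<sigma> \<and> j \<notin> C. cycle_weight A \<sigma> C)) *\<^sub>R
    cycle_prod B \<sigma> j" for \<sigma>
  \<comment> \<open>The minus sign is the sign change caused by joining; the cycle through
    \<open>k\<close> is left out because its product is written separately.\<close>
  define c where "c \<sigma> = - (cycle_sign \<sigma> * (\<Prod>C | C \<in> cycle_sets \<sigma> \<and> j \<notin> C \<and> k \<notin> C. cycle_weight A \<sigma> C))"
    for \<sigma>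
  let ?P = "{\<sigma> :: 'n \<Rightarrow> 'n. \<sigma> permutes UNIV}"
  let ?T1 = "{\<sigma> \<in> ?P. k \<in> set (cycle_from \<sigma> j)}" and ?T2 = "{\<sigma> \<in> ?P. k \<notin> set (cycle_from \<sigma> j)}"
  let ?t = "\<lambda>\<sigma>. Transposition.transpose j k \<circ> \<sigma>"
  \<comment> \<open>Separating \<open>j\<close> and \<open>k\<close> rewrites the summands of
    \<open>?T1\<close> over \<open>?T2\<close>; the joined product splits into two factors.\<close>
  have "(\<Sum>\<sigma>\<in>?T1. F \<sigma>) = (\<Sum>\<sigma>\<in>?T2. c \<sigma> *\<^sub>R (cycle_prod B \<sigma> j * cycle_prod A \<sigma> k))"
  proof (rule sum.reindex_bij_witness[of _ ?t ?t])
    fix \<sigma> assume "\<sigma> \<in> ?T1"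
    then show "?t (?t \<sigma>) = \<sigma>" and "?t \<sigma> \<in> ?T2"
      using cycle_from_split[OF _ assms(2)]
      by (simp_all add: transpose_comp_cancel transpose_comp_permutes)
  next
    fix \<sigma> assume \<sigma>: "\<sigma> \<in> ?T2"
    then show "?t (?t \<sigma>) = \<sigma>" by (simp add: transpose_comp_cancel)
    show "?t \<sigma> \<in> ?T1"
      using \<sigma> cycle_from_merge[of \<sigma> k j] cycle_from_self[of \<sigma> k] by (simp add: transpose_comp_permutes)
  next
    fix \<tau> assume \<tau>: "\<tau> \<in> ?T1"
    define \<sigma> where "\<sigma> = ?t \<tau>"
    have \<tau>_eq: "\<tau> = ?t \<sigma>" by (simp add: \<sigma>_def transpose_comp_cancel)
    have p: "\<sigma> permutes UNIV" and k: "k \<notin> set (cycle_from \<sigma> j)"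
      using \<tau> cycle_from_split[OF _ assms(2)] by (simp_all add: \<sigma>_def transpose_comp_permutes)
    have "(\<Prod>C | C \<in> cycle_sets \<tau> \<and> j \<notin> C. cycle_weight A \<tau> C) =
        (\<Prod>C | C \<in> cycle_sets \<sigma> \<and> j \<notin> C \<and> k \<notin> C. cycle_weight A \<sigma> C)"
      unfolding \<tau>_eq cycle_sets_merge[OF p k]
      by (intro prod.cong refl) (simp add: cycle_weight_merge[OF p k])
    then show "c (?t \<tau>) *\<^sub>R (cycle_prod B (?t \<tau>) j * cycle_prod A (?t \<tau>) k) = F \<tau>"
      unfolding \<sigma>_def[symmetric] F_def c_def
      unfolding \<tau>_eq by (simp add: cycle_sign_merge[OF p k] cycle_prod_merge[OF p k assms(2) B])
  qed
  \<comment> \<open>The cycle through \<open>k\<close> is disjoint from the one through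
    \<open>j\<close>, so its orientation can be averaged with the product of \<open>B\<close> held
    fixed.\<close>
  also have "\<dots> = (\<Sum>\<sigma>\<in>?T2. c \<sigma> *\<^sub>R (cycle_prod B \<sigma> j * of_real (Cq0 (cycle_prod A \<sigma> k))))"
  proof (rule sum_flip_cycle[OF assms(1)])
    fix \<sigma> assume \<sigma>: "\<sigma> \<in> ?T2"
    then show p: "\<sigma> permutes UNIV" by simp
    show "flip_cycle k \<sigma> \<in> ?T2"
      using \<sigma> by (simp add: flip_cycle_permutes set_cycle_from_flip)
    have "c (flip_cycle k \<sigma>) = c \<sigma>"
      unfolding c_def cycle_sets_flip[OF p] cycle_sign_flip[OF p]
      by (simp add: cycle_weight_flip[OF p])
    moreover have "j \<notin> set (cycle_from \<sigma> k)"
      using cycles_disjoint[of \<sigma> k j] \<sigma> cycle_from_self[OF p, of j] by auto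
    ultimately show "c (flip_cycle k \<sigma>) *\<^sub>R (cycle_prod B (flip_cycle k \<sigma>) j * q) =
        c \<sigma> *\<^sub>R (cycle_prod B \<sigma> j * q)" for q
      by (simp add: cycle_prod_flip_outside[OF p])
  qed (simp add: distrib_left scaleR_add_right)
  \<comment> \<open>The real part just produced is the missing weight of the cycle through
    \<open>k\<close>; up to sign this restores the original summand.\<close>
  also have "\<dots> = (\<Sum>\<sigma>\<in>?T2. - F \<sigma>)"
  proof (rule sum.cong[OF refl])
    fix \<sigma> assume "\<sigma> \<in> ?T2"
    then have p: "\<sigma> permutes UNIV" and k: "k \<notin> set (cycle_from \<sigma> j)" by simp_all
    have "(\<Prod>C | C \<in> cycle_sets \<sigma> \<and> j \<notin> C. cycle_weight A \<sigma> C) = Cq0 (cycle_prod A \<sigma> k) *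
        (\<Prod>C | C \<in> cycle_sets \<sigma> \<and> j \<notin> C \<and> k \<notin> C. cycle_weight A \<sigma> C)"
      using cycle_from_self[OF p, of k] unfolding cycle_sets_without_j[OF p k]
      by (subst prod.insert) (simp_all add: cycle_weight_cycle_from[OF p])
    then show "c \<sigma> *\<^sub>R (cycle_prod B \<sigma> j * of_real (Cq0 (cycle_prod A \<sigma> k))) = - F \<sigma>"
      by (simp add: c_def F_def of_real_def mult_ac)
  qed
  finally have "(\<Sum>\<sigma>\<in>?T1. F \<sigma>) + (\<Sum>\<sigma>\<in>?T2. F \<sigma>) = 0"
    by (simp add: sum_negf)
  moreover have "(\<Sum>\<sigma>\<in>?P. F \<sigma>) = (\<Sum>\<sigma>\<in>?T1. F \<sigma>) + (\<Sum>\<sigma>\<in>?T2. F \<sigma>)"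
    by (subst sum.union_disjoint[symmetric]) (auto intro: sum.cong)
  moreover have "cdet j B = (\<Sum>\<sigma>\<in>?P. F \<sigma>)"
    unfolding F_def by (rule cdet_real_weights[OF assms(1)]) (simp add: B)
  ultimately show ?thesis by (simp add: B_def)
qed

section \<open>Cramer's rule\<close>

text \<open>The cycle product started at \<open>j\<close> meets column \<open>j\<close> only in its
  last factor, so \<open>y\<close> enters once, at the far right. Both \<open>r\<close> and
  \<open>u\<close> are independent of \<open>y\<close>.\<close>

lemma cycle_prod_replace_col:
  fixes \<sigma> :: "'n::finite \<Rightarrow> 'n"
  assumes "\<sigma> permutes UNIV"
  obtains r u where "\<forall>y. cycle_prod (replace_col A j y) \<sigma> j = r * y $ u"
proof -
  let ?xs = "cycle_from \<sigma> j"
  obtain l where l: "?xs = j # l" by (rule cycle_from_Cons[OF assms])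
  have m: "map \<sigma> (j # l) = l @ [j]"
    using cycle_from_props(1)[OF assms, of j] by (simp add: cycle_list_def l)
  have d: "j \<notin> set l"
    using cycle_from_props(1)[OF assms, of j] by (simp add: cycle_list_def l)
  obtain us u where us: "j # l = us @ [u]" by (metis list.distinct(1) rev_exhaust)
  have "map \<sigma> us = l" "\<sigma> u = j" using m unfolding us by simp_all
  then have "\<sigma> t \<noteq> j" if "t \<in> set us" for t
    using that d by (metis image_eqI set_map)
  then have "prod_list (map (\<lambda>t. replace_col A j y $ t $ \<sigma> t) us) =
      prod_list (map (\<lambda>t. A $ t $ \<sigma> t) us)" for y
    by (intro arg_cong[where f=prod_list]) (simp add: replace_col_def)
  moreover have "replace_col A j y $ u $ \<sigma> u = y $ u" for y
    using \<open>\<sigma> u = j\<close> by (simp add: replace_col_def)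
  ultimately have "cycle_prod (replace_col A j y) \<sigma> j = prod_list (map (\<lambda>t. A $ t $ \<sigma> t) us) * y $ u" for y
    by (simp add: cycle_prod_eq path_prod_def l us)
  then show thesis using that by blast
qed

text \<open>Each averaged summand has the form \<open>r * y $ u\<close> up to a real scalar, hence
  is right linear in \<open>y\<close>; the unit columns pick out the coefficients.\<close>

lemma cdet_replace_col_linear:
  fixes A :: "coquat^'n::{finite,linorder}^'n::{finite,linorder}"
  assumes "hermitian A"
  shows "cdet j (replace_col A j y) = (\<Sum>i\<in>UNIV. cdet j (replace_col A j (axis i 1)) * y $ i)"
proof -
  define c where "c \<sigma> = cycle_sign \<sigma> * (\<Prod>C | C \<in> cycle_sets \<sigma> \<and> j \<notin> C. cycle_weight A \<sigma> C)" for \<sigma>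
  have cdet: "cdet j (replace_col A j z) =
      (\<Sum>\<sigma> | \<sigma> permutes UNIV. c \<sigma> *\<^sub>R cycle_prod (replace_col A j z) \<sigma> j)" for z
    unfolding c_def by (rule cdet_real_weights[OF assms]) (simp add: replace_col_def)
  have lin: "cycle_prod (replace_col A j y) \<sigma> j =
      (\<Sum>i\<in>UNIV. cycle_prod (replace_col A j (axis i 1)) \<sigma> j * y $ i)" if p: "\<sigma> permutes UNIV" for \<sigma>
  proof -
    obtain r u where ru: "\<forall>y. cycle_prod (replace_col A j y) \<sigma> j = r * y $ u"
      by (rule cycle_prod_replace_col[OF p, of A j])
    have "(\<Sum>i\<in>UNIV. r * axis i 1 $ u * y $ i) = (\<Sum>i\<in>UNIV. if i = u then r * y $ i else 0)"
      by (intro sum.cong refl) (simp add: axis_def)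
    then show ?thesis by (simp add: ru)
  qed
  have "cdet j (replace_col A j y) = (\<Sum>\<sigma> | \<sigma> permutes UNIV. \<Sum>i\<in>UNIV.
      c \<sigma> *\<^sub>R cycle_prod (replace_col A j (axis i 1)) \<sigma> j * y $ i)"
    unfolding cdet by (intro sum.cong refl) (simp add: lin scaleR_sum_right)
  also have "\<dots> = (\<Sum>i\<in>UNIV. cdet j (replace_col A j (axis i 1)) * y $ i)"
    by (subst sum.swap) (simp add: cdet sum_distrib_right)
  finally show ?thesis .
qed

lemma conj_transpose_mult: "conj_transpose (A ** B) = conj_transpose B ** conj_transpose A"
  by (simp add: conj_transpose_def matrix_matrix_mult_def vec_eq_iff cq_cnj_sum cq_cnj_mult)

theorem theorem4p4:
  fixes A :: "coquat^'n::{finite,linorder}^'n::{finite,linorder}" and x y :: "coquat^'n::{finite,linorder}"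
  assumes "hermitian A" and "hdet A \<noteq> 0"
  shows "A *v x = y \<longleftrightarrow> (\<forall>j. x $ j = cdet j (replace_col A j y) /\<^sub>R hdet A)"
proof -
  define d where "d = hdet A"
  \<comment> \<open>Solution operator of Cramer's rule: its entries are the values of the right
    linear maps in \<open>y\<close> at the unit columns.\<close>
  define L :: "coquat^'n::{finite,linorder}^'n::{finite,linorder}" where "L = (\<chi> j i. cdet j (replace_col A j (axis i 1)) /\<^sub>R d)"
  have L: "cdet j (replace_col A j z) /\<^sub>R d = (L *v z) $ j" for j z
    unfolding cdet_replace_col_linear[OF assms(1), of j z]
    by (simp add: L_def matrix_vector_mult_def scaleR_sum_right)
  \<comment> \<open>Inserting column \<open>k\<close> of \<open>A\<close> at position
    \<open>j\<close> yields either \<open>A\<close> itself or a repeated column.\<close>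
  have "cdet j (replace_col A j (column k A)) = (if j = k then of_real d else 0)" for j k
  proof (cases "j = k")
    case True
    have "replace_col A k (column k A) = A"
      by (simp add: replace_col_def column_def vec_eq_iff)
    with True show ?thesis
      by (simp add: d_def hdet_hermitian[OF assms(1)] cdet_hermitian[OF assms(1)])
  qed (simp add: cdet_repeated_column[OF assms(1)])
  then have "(L *v column k A) $ j = (if j = k then 1 else 0)" for j k
    using assms(2) by (simp add: L[symmetric] of_real_def d_def)
  then have LA: "L ** A = mat 1"
    by (simp add: vec_eq_iff matrix_matrix_mult_def matrix_vector_mult_def column_def mat_def)
  \<comment> \<open>Conjugate transposition of \<open>L ** A = mat 1\<close> exchanges the factors
    and fixes \<open>A\<close>, producing a right inverse.\<close>
  have "A ** conj_transpose L = conj_transpose (L ** A)"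
    using assms(1) by (simp add: conj_transpose_mult hermitian_def)
  also have "\<dots> = mat 1"
    unfolding LA by (simp add: conj_transpose_def mat_def vec_eq_iff)
  finally have AL': "A ** conj_transpose L = mat 1" .
  \<comment> \<open>A left and a right inverse coincide by associativity.\<close>
  have "conj_transpose L = L ** A ** conj_transpose L" by (simp add: LA)
  also have "\<dots> = L" unfolding matrix_mul_assoc[symmetric] AL' by simp
  finally have AL: "A ** L = mat 1" using AL' by simp
  \<comment> \<open>Uniqueness of the solution comes from \<open>L ** A = mat 1\<close>, existence
    from \<open>A ** L = mat 1\<close>.\<close>
  have "A *v x = y \<longleftrightarrow> x = L *v y"
    using LA AL by (metis matrix_vector_mul_assoc matrix_vector_mul_lid)
  then show ?thesis
    unfolding d_def[symmetric] L by (simp add: vec_eq_iff)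
qed

end
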